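(* Let $A\subset\omega$ and let $\delta\in[0,1]$. Then $A$ has asymptotic density $\delta$ in $\omega$ if and only if $A\times A$ has asymptotic density $\delta^2$ in $\omega\times\omega$. In particular, $A$ is asymptotically dense in $\omega$ if and only if $A\times A$ is asymptotically dense in $\omega\times\omega$.
   Context: Identify $n$ with $\{0,1,\dots,n-1\}$. A set $S\subseteq\omega$ has asymptotic density $\delta$ if $\lim_{n\to\infty}|S\cap n|/n=\delta$. A set $S\subseteq\omega\times\omega$ has asymptotic density $\delta$ if $\lim_{n\to\infty}|S\cap(n\times n)|/n^2=\delta$. A set is asymptotically dense if it has asymptotic density 1. *)

theory Defs
  imports Complex_Main
begin

(* The natural number n is identified with {0,...,n-1} = {..<n}. The quotients at n = 0 are 0 / 0 = 0
   in HOL and do not affect the limits. *)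

definition has_density :: "nat set \<Rightarrow> real \<Rightarrow> bool" where
  "has_density S \<delta> \<longleftrightarrow> (\<lambda>n. real (card (S \<inter> {..<n})) / real n) \<longlonglongrightarrow> \<delta>"

definition has_density2 :: "(nat \<times> nat) set \<Rightarrow> real \<Rightarrow> bool" where
  "has_density2 S \<delta> \<longleftrightarrow>
     (\<lambda>n. real (card (S \<inter> ({..<n} \<times> {..<n}))) / (real n)\<^sup>2) \<longlonglongrightarrow> \<delta>"

definition asymptotically_dense :: "nat set \<Rightarrow> bool" where
  "asymptotically_dense S \<longleftrightarrow> has_density S 1"

definition asymptotically_dense2 :: "(nat \<times> nat) set \<Rightarrow> bool" where
  "asymptotically_dense2 S \<longleftrightarrow> has_density2 S 1"

end

theory Submission
  imports Defs
begin

text \<open>The part of \<open>A \<times> A\<close> inside the square \<open>n \<times> n\<close> is itself the square of the part of \<open>A\<close> below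
  \<open>n\<close>, so the proportions for \<open>A \<times> A\<close> are exactly the squares of those for \<open>A\<close>. Squaring is a
  homeomorphism of the nonnegative reals: its continuity gives one direction, continuity of the
  square root the other. The statement on denseness is the case \<open>\<delta> = 1\<close>.\<close>

lemma square_proportion:
  "real (card ((A \<times> A) \<inter> ({..<n} \<times> {..<n}))) / (real n)\<^sup>2 =
    (real (card (A \<inter> {..<n})) / real n)\<^sup>2"
  by (simp add: Times_Int_Times card_cartesian_product power_divide power2_eq_square)

lemma tendsto_power2_iff_nonneg:
  fixes f :: "'a \<Rightarrow> real"
  assumes f: "\<And>x. 0 \<le> f x" and l: "0 \<le> l"
  shows "((\<lambda>x. (f x)\<^sup>2) \<longlongrightarrow> l\<^sup>2) F \<longleftrightarrow> (f \<longlongrightarrow> l) F"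
proof
  assume "((\<lambda>x. (f x)\<^sup>2) \<longlongrightarrow> l\<^sup>2) F"
  then have "((\<lambda>x. sqrt ((f x)\<^sup>2)) \<longlongrightarrow> sqrt (l\<^sup>2)) F"
    by (rule tendsto_real_sqrt)
  then show "(f \<longlongrightarrow> l) F"
    using f l by simp
qed (rule tendsto_power)

lemma has_density_iff_has_density2_square:
  assumes "0 \<le> \<delta>"
  shows "has_density A \<delta> \<longleftrightarrow> has_density2 (A \<times> A) (\<delta>\<^sup>2)"
  unfolding has_density_def has_density2_def square_proportion
  using assms by (simp add: tendsto_power2_iff_nonneg)

theorem lemma1p3:
  fixes A :: "nat set"
  shows "(\<forall>\<delta>::real. \<delta> \<in> {0..1} \<longrightarrow> (has_density A \<delta> \<longleftrightarrow> has_density2 (A \<times> A) (\<delta>\<^sup>2)))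
       \<and> (asymptotically_dense A \<longleftrightarrow> asymptotically_dense2 (A \<times> A))"
  using has_density_iff_has_density2_square[of _ A] has_density_iff_has_density2_square[of 1 A]
  by (simp add: asymptotically_dense_def asymptotically_dense2_def)

end
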